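(* Let $\mathcal{I}'\subseteq\mathcal{I}$ and $\mathcal{J}'\subseteq\mathcal{J}$ be ideals of $R$ such that $\mathcal{I}\cap\mathcal{J}=\mathcal{I}\mathcal{J}$ (for example, such that $\mathcal{I}$ and $\mathcal{J}$ are Tor-independent). Set $W=R/(\mathcal{I}+\mathcal{J})$. Then there is a ring isomorphism \[\frac{R}{\langle\mathcal{I}',\mathcal{I}\mathcal{J},\mathcal{J}'\rangle}\cong\frac{R}{\mathcal{I}'+\mathcal{J}}\times_W\frac{R}{\mathcal{I}+\mathcal{J}'}.\]
   Context: $R$ is a commutative ring that is local or standard graded. For ring surjections $\pi_S:S\to W$ and $\pi_T:T\to W$, the fiber product is $S\times_WT=\{(s,t)\in S\times T:\pi_S(s)=\pi_T(t)\}$; here the maps to $W$ are the natural surjections. Ideals $\mathcal{I},\mathcal{J}$ are Tor-independent if $\operatorname{Tor}_i^R(R/\mathcal{I},R/\mathcal{J})=0$ for all $i\ge1$. $\langle\mathcal{I}',\mathcal{I}\mathcal{J},\mathcal{J}'\rangle=\mathcal{I}'+\mathcal{I}\mathcal{J}+\mathcal{J}'$. *)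

theory Defs
  imports "HOL-Algebra.Chinese_Remainder" "HOL-Algebra.Generated_Rings" "HOL-Algebra.Module"
begin

section \<open>Local and standard graded rings\<close>

text \<open>Local rings are not required to be Noetherian.\<close>

definition local_ring :: "('a, 'm) ring_scheme \<Rightarrow> bool"
  where "local_ring R \<longleftrightarrow> cring R \<and> (\<exists>!\<mm>. maximalideal \<mm> R)"

definition graded_by :: "('a, 'm) ring_scheme \<Rightarrow> (nat \<Rightarrow> 'a set) \<Rightarrow> bool"
  where "graded_by R G \<longleftrightarrow>
    cring R \<and>
    (\<forall>n. additive_subgroup (G n) R) \<and>
    (\<forall>x\<in>carrier R. \<exists>!f. (\<forall>n. f n \<in> G n) \<and> finite {n. f n \<noteq> \<zero>\<^bsub>R\<^esub>} \<and>
        x = finsum R f {n. f n \<noteq> \<zero>\<^bsub>R\<^esub>}) \<and>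
    (\<forall>m n. \<forall>x\<in>G m. \<forall>y\<in>G n. x \<otimes>\<^bsub>R\<^esub> y \<in> G (m + n))"

text \<open>The degree-zero part is a field, over which the ring is generated as an algebra by
  finitely many elements of degree one.\<close>

definition standard_graded_ring :: "('a, 'm) ring_scheme \<Rightarrow> bool"
  where "standard_graded_ring R \<longleftrightarrow>
    (\<exists>G. graded_by R G \<and> subfield (G 0) R \<and>
      (\<exists>S. finite S \<and> S \<subseteq> G 1 \<and> carrier R = generate_ring R (G 0 \<union> S)))"


section \<open>Fiber products of rings\<close>

definition fiber_product ::
    "('a, 'm) ring_scheme \<Rightarrow> ('b, 'n) ring_scheme \<Rightarrow> ('a \<Rightarrow> 'w) \<Rightarrow> ('b \<Rightarrow> 'w) \<Rightarrow> ('a \<times> 'b) ring"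
  where "fiber_product S T \<pi>S \<pi>T =
    RDirProd S T \<lparr>carrier := {(s, t). s \<in> carrier S \<and> t \<in> carrier T \<and> \<pi>S s = \<pi>T t}\<rparr>"

text \<open>For ideals \<open>A \<subseteq> K\<close>, the natural surjection from \<open>R Quot A\<close> to \<open>R Quot K\<close>: the map induced by
  \<open>x \<mapsto> K + x\<close>, which is constant on each coset \<open>C\<close> of \<open>A\<close>.\<close>

definition quot_proj :: "('a, 'm) ring_scheme \<Rightarrow> 'a set \<Rightarrow> 'a set \<Rightarrow> 'a set"
  where "quot_proj R K C = the_elem ((\<lambda>x. K +>\<^bsub>R\<^esub> x) ` C)"


section \<open>Modules\<close>

text \<open>The record type of modules extends that of rings; the fields \<open>mult\<close> and \<open>one\<close> play no role
  for modules and are left undefined below.\<close>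

definition module_hom ::
    "('a, 'm) ring_scheme \<Rightarrow> ('a, 'b, 'n) module_scheme \<Rightarrow> ('a, 'c, 'o) module_scheme \<Rightarrow> ('b \<Rightarrow> 'c) set"
  where "module_hom R M N =
    {f. f \<in> carrier M \<rightarrow> carrier N \<and>
        (\<forall>x\<in>carrier M. \<forall>y\<in>carrier M. f (x \<oplus>\<^bsub>M\<^esub> y) = f x \<oplus>\<^bsub>N\<^esub> f y) \<and>
        (\<forall>a\<in>carrier R. \<forall>x\<in>carrier M. f (a \<odot>\<^bsub>M\<^esub> x) = a \<odot>\<^bsub>N\<^esub> f x)}"

definition regular_module :: "('a, 'm) ring_scheme \<Rightarrow> ('a, 'a) module"
  where "regular_module R =
    \<lparr>carrier = carrier R, mult = undefined, one = undefined,
     zero = \<zero>\<^bsub>R\<^esub>, add = add R, smult = (\<otimes>\<^bsub>R\<^esub>)\<rparr>"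

definition quotient_module :: "('a, 'b, 'n) module_scheme \<Rightarrow> 'b set \<Rightarrow> ('a, 'b set) module"
  where "quotient_module M N =
    \<lparr>carrier = a_rcosets\<^bsub>M\<^esub> N, mult = undefined, one = undefined,
     zero = N, add = set_add M, smult = (\<lambda>a C. \<Union>x\<in>C. N +>\<^bsub>M\<^esub> (a \<odot>\<^bsub>M\<^esub> x))\<rparr>"

definition submodule_span ::
    "('a, 'm) ring_scheme \<Rightarrow> ('a, 'b, 'n) module_scheme \<Rightarrow> 'b set \<Rightarrow> 'b set"
  where "submodule_span R M S = \<Inter>{N. submodule N R M \<and> S \<subseteq> N}"

text \<open>The free module on a set \<open>B\<close>: finitely supported functions from \<open>B\<close> to \<open>R\<close>, extended by zero
  outside \<open>B\<close>.\<close>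

definition free_module :: "('a, 'm) ring_scheme \<Rightarrow> 'b set \<Rightarrow> ('a, 'b \<Rightarrow> 'a) module"
  where "free_module R B =
    \<lparr>carrier = {f. (\<forall>b. f b \<in> carrier R) \<and> (\<forall>b. b \<notin> B \<longrightarrow> f b = \<zero>\<^bsub>R\<^esub>) \<and>
                   finite {b. f b \<noteq> \<zero>\<^bsub>R\<^esub>}},
     mult = undefined, one = undefined,
     zero = (\<lambda>b. \<zero>\<^bsub>R\<^esub>), add = (\<lambda>f g b. f b \<oplus>\<^bsub>R\<^esub> g b), smult = (\<lambda>a f b. a \<otimes>\<^bsub>R\<^esub> f b)\<rparr>"

definition basis_vec :: "('a, 'm) ring_scheme \<Rightarrow> 'b \<Rightarrow> 'b \<Rightarrow> 'a"
  where "basis_vec R b = (\<lambda>c. if c = b then \<one>\<^bsub>R\<^esub> else \<zero>\<^bsub>R\<^esub>)"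


section \<open>Tensor products\<close>

definition tensor_relations ::
    "('a, 'm) ring_scheme \<Rightarrow> ('a, 'b, 'n) module_scheme \<Rightarrow> ('a, 'c, 'o) module_scheme
      \<Rightarrow> ('b \<times> 'c \<Rightarrow> 'a) set"
  where "tensor_relations R M N =
    (let F = free_module R (carrier M \<times> carrier N); e = (\<lambda>x y. basis_vec R (x, y)) in
      {e (x \<oplus>\<^bsub>M\<^esub> x') y \<ominus>\<^bsub>F\<^esub> (e x y \<oplus>\<^bsub>F\<^esub> e x' y) | x x' y.
          x \<in> carrier M \<and> x' \<in> carrier M \<and> y \<in> carrier N} \<union>
      {e x (y \<oplus>\<^bsub>N\<^esub> y') \<ominus>\<^bsub>F\<^esub> (e x y \<oplus>\<^bsub>F\<^esub> e x y') | x y y'.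
          x \<in> carrier M \<and> y \<in> carrier N \<and> y' \<in> carrier N} \<union>
      {e (a \<odot>\<^bsub>M\<^esub> x) y \<ominus>\<^bsub>F\<^esub> a \<odot>\<^bsub>F\<^esub> e x y | a x y.
          a \<in> carrier R \<and> x \<in> carrier M \<and> y \<in> carrier N} \<union>
      {e x (a \<odot>\<^bsub>N\<^esub> y) \<ominus>\<^bsub>F\<^esub> a \<odot>\<^bsub>F\<^esub> e x y | a x y.
          a \<in> carrier R \<and> x \<in> carrier M \<and> y \<in> carrier N})"

definition tensor_kernel ::
    "('a, 'm) ring_scheme \<Rightarrow> ('a, 'b, 'n) module_scheme \<Rightarrow> ('a, 'c, 'o) module_scheme
      \<Rightarrow> ('b \<times> 'c \<Rightarrow> 'a) set"
  where "tensor_kernel R M N =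
    submodule_span R (free_module R (carrier M \<times> carrier N)) (tensor_relations R M N)"

definition tensor_product ::
    "('a, 'm) ring_scheme \<Rightarrow> ('a, 'b, 'n) module_scheme \<Rightarrow> ('a, 'c, 'o) module_scheme
      \<Rightarrow> ('a, ('b \<times> 'c \<Rightarrow> 'a) set) module"
  where "tensor_product R M N =
    quotient_module (free_module R (carrier M \<times> carrier N)) (tensor_kernel R M N)"

definition pure_tensor ::
    "('a, 'm) ring_scheme \<Rightarrow> ('a, 'b, 'n) module_scheme \<Rightarrow> ('a, 'c, 'o) module_scheme
      \<Rightarrow> 'b \<Rightarrow> 'c \<Rightarrow> ('b \<times> 'c \<Rightarrow> 'a) set"
  where "pure_tensor R M N x y =
    tensor_kernel R M N +>\<^bsub>free_module R (carrier M \<times> carrier N)\<^esub> basis_vec R (x, y)"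

text \<open>\<open>g\<close> is the map induced by \<open>f : M \<rightarrow> M'\<close> on tensor products with \<open>N\<close>; since pure tensors
  generate the tensor product, this determines \<open>g\<close> on the carrier.\<close>

definition is_tensor_map ::
    "('a, 'm) ring_scheme \<Rightarrow> ('a, 'b, 'n) module_scheme \<Rightarrow> ('a, 'd, 'p) module_scheme
      \<Rightarrow> ('a, 'c, 'o) module_scheme \<Rightarrow> ('b \<Rightarrow> 'd)
      \<Rightarrow> (('b \<times> 'c \<Rightarrow> 'a) set \<Rightarrow> ('d \<times> 'c \<Rightarrow> 'a) set) \<Rightarrow> bool"
  where "is_tensor_map R M M' N f g \<longleftrightarrow>
    g \<in> module_hom R (tensor_product R M N) (tensor_product R M' N) \<and>
    (\<forall>x\<in>carrier M. \<forall>y\<in>carrier N. g (pure_tensor R M N x y) = pure_tensor R M' N (f x) y)"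


section \<open>Tor-independence\<close>

text \<open>\<open>\<dots> \<rightarrow> F\<^sub>2 \<rightarrow> F\<^sub>1 \<rightarrow> F\<^sub>0 \<rightarrow> M \<rightarrow> 0\<close> is exact, where \<open>F\<^sub>n\<close> is the free module on \<open>B n\<close>, the map
  \<open>F\<^sub>n\<^sub>+\<^sub>1 \<rightarrow> F\<^sub>n\<close> is \<open>d n\<close>, and the augmentation is \<open>\<epsilon>\<close>.\<close>

definition free_resolution ::
    "('a, 'm) ring_scheme \<Rightarrow> ('a, 'b, 'n) module_scheme \<Rightarrow> (nat \<Rightarrow> 'x set)
      \<Rightarrow> (nat \<Rightarrow> ('x \<Rightarrow> 'a) \<Rightarrow> ('x \<Rightarrow> 'a)) \<Rightarrow> (('x \<Rightarrow> 'a) \<Rightarrow> 'b) \<Rightarrow> bool"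
  where "free_resolution R M B d \<epsilon> \<longleftrightarrow>
    (let F = (\<lambda>n. free_module R (B n)) in
      \<epsilon> \<in> module_hom R (F 0) M \<and>
      (\<forall>n. d n \<in> module_hom R (F (Suc n)) (F n)) \<and>
      \<epsilon> ` carrier (F 0) = carrier M \<and>
      d 0 ` carrier (F 1) = a_kernel (F 0) M \<epsilon> \<and>
      (\<forall>n. d (Suc n) ` carrier (F (Suc (Suc n))) = a_kernel (F (Suc n)) (F n) (d n)))"

text \<open>For \<open>i \<ge> 1\<close>: \<open>Tor\<^sub>i(M, N) = 0\<close>, i.e. the \<open>i\<close>-th homology of \<open>F \<otimes> N\<close> vanishes, where \<open>F\<close> is a free
  resolution of \<open>M\<close>; this does not depend on the choice of \<open>F\<close>. The bases are taken inside one
  fixed infinite type \<open>('a + 'b) list\<close>, which is at least as large as \<open>R\<close> and \<open>M\<close>. It has at least as many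
  elements as there are finitely supported functions from it to \<open>R\<close>, so the kernel at each step is
  again generated by a family indexed by a subset of it, and a free resolution of this form exists.\<close>

definition Tor_vanishes ::
    "('a, 'm) ring_scheme \<Rightarrow> nat \<Rightarrow> ('a, 'b, 'n) module_scheme \<Rightarrow> ('a, 'c, 'o) module_scheme \<Rightarrow> bool"
  where "Tor_vanishes R i M N \<longleftrightarrow>
    (\<exists>(B :: nat \<Rightarrow> ('a + 'b) list set) d \<epsilon> D.
      free_resolution R M B d \<epsilon> \<and>
      (\<forall>n. is_tensor_map R (free_module R (B (Suc n))) (free_module R (B n)) N (d n) (D n)) \<and>
      a_kernel (tensor_product R (free_module R (B i)) N)
               (tensor_product R (free_module R (B (i - 1))) N) (D (i - 1)) =
        D i ` carrier (tensor_product R (free_module R (B (Suc i))) N))"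

definition Tor_independent :: "('a, 'm) ring_scheme \<Rightarrow> 'a set \<Rightarrow> 'a set \<Rightarrow> bool"
  where "Tor_independent R I J \<longleftrightarrow>
    (\<forall>i\<ge>1. Tor_vanishes R i (quotient_module (regular_module R) I)
                            (quotient_module (regular_module R) J))"

end

theory Submission
  imports Defs
begin

text \<open>The isomorphism is an instance of a fact about any two ideals \<open>A\<close> and \<open>B\<close>: the map
  \<open>x \<mapsto> (A + x, B + x)\<close> has kernel \<open>A \<inter> B\<close>, and its image consists of the pairs that agree modulo
  \<open>A + B\<close> (\<open>quot_inter_iso_fiber_product\<close>). For \<open>A = I' + J\<close> and \<open>B = I + J'\<close> the sum is \<open>I + J\<close>, and
  the intersection is \<open>I' + (I \<inter> J) + J'\<close> (\<open>inter_of_sums\<close>), because in \<open>i' + j = i + j'\<close> the element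
  \<open>j - j' = i - i'\<close> lies in both \<open>I\<close> and \<open>J\<close>. The hypothesis \<open>I \<inter> J = I J\<close> turns this into the
  denominator on the left-hand side.

  That Tor-independence gives \<open>I \<inter> J = I J\<close> reflects the isomorphism between
  \<open>Tor\<^sub>1(R/I, R/J)\<close> and \<open>(I \<inter> J)/(I J)\<close>. It is read off by elements from any free
  resolution \<open>\<dots> \<rightarrow> F\<^sub>2 \<rightarrow> F\<^sub>1 \<rightarrow> F\<^sub>0 \<rightarrow> R/I\<close> whose first homology
  vanishes after tensoring with \<open>R/J\<close> (\<open>Tor_1_vanishes_imp_inter_eq_prod\<close>). As \<open>F\<^sub>0\<close> is free, the augmentation lifts to
  \<open>\<phi> : F\<^sub>0 \<rightarrow> R\<close>, and \<open>\<psi> = \<phi> \<circ> d\<^sub>0\<close> takes values in \<open>I\<close>. Hence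
  \<open>f \<otimes> (J + r) \<mapsto> I J + \<psi>(f) r\<close> is a well-defined map on
  \<open>F\<^sub>1 \<otimes> R/J\<close>, and it vanishes on boundaries, since \<open>\<psi> \<circ> d\<^sub>1 = 0\<close>.
  Given \<open>a \<in> I \<inter> J\<close>, choose \<open>e\<close> over \<open>1 \<in> R/I\<close>. Since \<open>a \<in> I\<close>, the element \<open>a e\<close> is \<open>d\<^sub>0 f\<close> for
  some \<open>f\<close>; since \<open>a \<in> J\<close>, the tensor \<open>f \<otimes> 1\<close> is a cycle, hence a boundary. Thus
  \<open>a \<phi>(e) = \<psi>(f) \<in> I J\<close>, and \<open>a - a \<phi>(e) \<in> I J\<close> because \<open>\<phi>(e) \<equiv> 1\<close> modulo \<open>I\<close>.

  The remaining lemmas supply the module theory behind this argument: universal properties of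
  quotients, free modules and tensor products. Homomorphisms out of these are only ever
  handled through their values on cosets, basis vectors and pure tensors.\<close>


section \<open>Quotients by an intersection of two ideals\<close>

lemma set_addI:
  assumes "x \<in> A" "y \<in> B"
  shows "x \<oplus>\<^bsub>R\<^esub> y \<in> A <+>\<^bsub>R\<^esub> B"
  using assms by (auto simp: set_add_def')

text \<open>The projection is defined by applying \<open>x \<mapsto> K + x\<close> to every element of a coset; all values agree because
  the coset has differences in \<open>A \<subseteq> K\<close>.\<close>

lemma (in ring) quot_proj_coset:
  assumes "ideal A R" "ideal K R" "A \<subseteq> K" "x \<in> carrier R"
  shows "quot_proj R K (A +> x) = K +> x"
proof -
  interpret A: ideal A R by fact
  interpret K: ideal K R by fact
  have "K +> y = K +> x" if "y \<in> A +> x" for y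
  proof -
    obtain h where "h \<in> A" "y = h \<oplus> x"
      using \<open>y \<in> A +> x\<close> by (auto simp: a_r_coset_def')
    hence "y \<in> K +> x"
      using assms by (auto simp: a_r_coset_def')
    thus ?thesis
      using K.a_repr_independence'[OF _ assms(4)] by simp
  qed
  moreover have "x \<in> A +> x"
    using A.a_rcos_self assms(4) by simp
  ultimately have "(\<lambda>y. K +> y) ` (A +> x) = {K +> x}"
    by blast
  thus ?thesis
    by (simp add: quot_proj_def)
qed

lemma RDirProd_zero: "\<zero>\<^bsub>RDirProd S T\<^esub> = (\<zero>\<^bsub>S\<^esub>, \<zero>\<^bsub>T\<^esub>)"
  by (simp add: RDirProd_def DirProd_def monoid.defs)

text \<open>Two cosets \<open>A + x\<close> and \<open>B + y\<close> with the same image in \<open>R/(A + B)\<close> satisfy \<open>x - y = i + j\<close> with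
  \<open>i \<in> A\<close> and \<open>j \<in> B\<close>, so that \<open>j + y = x - i\<close> represents both. This identifies the fiber product with
  the image of the map \<open>x \<mapsto> (A + x, B + x)\<close> into the full product, and the first isomorphism
  theorem applies.\<close>

theorem (in cring) quot_inter_iso_fiber_product:
  assumes "ideal A R" "ideal B R"
  shows "R Quot (A \<inter> B) \<simeq>
    fiber_product (R Quot A) (R Quot B) (quot_proj R (A <+>\<^bsub>R\<^esub> B)) (quot_proj R (A <+>\<^bsub>R\<^esub> B))"
proof -
  interpret A: ideal A R by fact
  interpret B: ideal B R by fact
  have K: "ideal (A <+>\<^bsub>R\<^esub> B) R"
    using assms by (rule add_ideals)
  interpret K: ideal "A <+>\<^bsub>R\<^esub> B" R by fact
  have AK: "A \<subseteq> A <+>\<^bsub>R\<^esub> B"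
  proof
    fix x assume "x \<in> A"
    hence "x = x \<oplus> \<zero>"
      by simp
    thus "x \<in> A <+>\<^bsub>R\<^esub> B"
      using \<open>x \<in> A\<close> B.zero_closed by (metis set_addI)
  qed
  have BK: "B \<subseteq> A <+>\<^bsub>R\<^esub> B"
  proof
    fix x assume "x \<in> B"
    hence "x = \<zero> \<oplus> x"
      by simp
    thus "x \<in> A <+>\<^bsub>R\<^esub> B"
      using \<open>x \<in> B\<close> A.zero_closed by (metis set_addI)
  qed
  let ?S = "R Quot A" and ?T = "R Quot B"
  let ?h = "\<lambda>x. (A +> x, B +> x)"
  have hom: "?h \<in> ring_hom R (RDirProd ?S ?T)"
    using A.rcos_ring_hom B.rcos_ring_hom
    by (auto simp: ring_hom_def RDirProd_def DirProd_def monoid.defs)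
  interpret h: ring_hom_ring R "RDirProd ?S ?T" ?h
    using RDirProd_ring[OF A.quotient_is_ring B.quotient_is_ring] hom ring_axioms
    by (auto intro!: ring_hom_ringI2)
  have ker: "a_kernel R (RDirProd ?S ?T) ?h = A \<inter> B"
  proof -
    have A: "A +> x = A \<longleftrightarrow> x \<in> A" if "x \<in> carrier R" for x
      using that A.a_rcos_self A.a_rcos_const by metis
    have B: "B +> x = B \<longleftrightarrow> x \<in> B" if "x \<in> carrier R" for x
      using that B.a_rcos_self B.a_rcos_const by metis
    have zero: "\<zero>\<^bsub>RDirProd ?S ?T\<^esub> = (A, B)"
      by (simp only: RDirProd_zero) (simp only: FactRing_def ring.simps)
    have "x \<in> a_kernel R (RDirProd ?S ?T) ?h \<longleftrightarrow> x \<in> A \<inter> B" for x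
    proof (cases "x \<in> carrier R")
      case True
      thus ?thesis
        by (simp only: a_kernel_def' mem_Collect_eq zero prod.inject A[OF True] B[OF True] Int_iff simp_thms)
    next
      case False
      thus ?thesis
        using A.a_subset unfolding a_kernel_def' by blast
    qed
    thus ?thesis
      by blast
  qed
  have "(\<exists>z\<in>carrier R. A +> z = A +> x \<and> B +> z = B +> y)"
    if xy: "x \<in> carrier R" "y \<in> carrier R" and eq: "(A <+>\<^bsub>R\<^esub> B) +> x = (A <+>\<^bsub>R\<^esub> B) +> y" for x y
  proof -
    have "x \<ominus> y \<in> A <+>\<^bsub>R\<^esub> B"
      using K.a_rcos_module_minus[OF ring_axioms xy(2,1)] K.a_rcos_self[OF xy(1)] eq by simp
    then obtain i j where ij: "i \<in> A" "j \<in> B" "x \<ominus> y = i \<oplus> j"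
      by (auto simp: set_add_def')
    have c: "i \<in> carrier R" "j \<in> carrier R"
      using ij A.a_subset B.a_subset by auto
    have "x = (x \<ominus> y) \<oplus> y"
      using xy by algebra
    also have "\<dots> = i \<oplus> (j \<oplus> y)"
      using ij c xy by (simp add: a_assoc)
    finally have "x \<in> A +> (j \<oplus> y)"
      using ij by (auto simp: a_r_coset_def')
    moreover have "j \<oplus> y \<in> B +> y"
      using ij by (auto simp: a_r_coset_def')
    ultimately show ?thesis
      using c xy A.a_repr_independence' B.a_repr_independence'
      by (metis a_closed)
  qed
  hence "?h ` carrier R = carrier (fiber_product ?S ?T (quot_proj R (A <+>\<^bsub>R\<^esub> B)) (quot_proj R (A <+>\<^bsub>R\<^esub> B)))"
    using quot_proj_coset[OF assms(1) K AK] quot_proj_coset[OF assms(2) K BK]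
    by (auto simp: fiber_product_def FactRing_def A_RCOSETS_def' image_iff) metis
  hence "fiber_product ?S ?T (quot_proj R (A <+>\<^bsub>R\<^esub> B)) (quot_proj R (A <+>\<^bsub>R\<^esub> B))
      = RDirProd ?S ?T \<lparr>carrier := ?h ` carrier R\<rparr>"
    by (simp add: fiber_product_def)
  thus ?thesis
    using h.FactRing_iso_set_aux ker unfolding is_ring_iso_def by auto
qed

lemma (in cring) sum_of_sums:
  assumes "ideal I R" "ideal J R" "ideal I' R" "ideal J' R" "I' \<subseteq> I" "J' \<subseteq> J"
  shows "(I' <+>\<^bsub>R\<^esub> J) <+>\<^bsub>R\<^esub> (I <+>\<^bsub>R\<^esub> J') = I <+>\<^bsub>R\<^esub> J"
proof -
  interpret I: ideal I R by fact
  interpret J: ideal J R by fact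
  interpret I': ideal I' R by fact
  interpret J': ideal J' R by fact
  show ?thesis
  proof (intro equalityI subsetI)
    fix x assume "x \<in> (I' <+>\<^bsub>R\<^esub> J) <+>\<^bsub>R\<^esub> (I <+>\<^bsub>R\<^esub> J')"
    then obtain i' j i j' where "i' \<in> I'" "j \<in> J" "i \<in> I" "j' \<in> J'" "x = (i' \<oplus> j) \<oplus> (i \<oplus> j')"
      by (auto simp: set_add_def')
    moreover from this have "x = (i' \<oplus> i) \<oplus> (j \<oplus> j')"
      using add.m_assoc add.m_comm by (simp add: a_ac)
    moreover have "i' \<oplus> i \<in> I" "j \<oplus> j' \<in> J"
      using calculation assms(5,6) by auto
    ultimately show "x \<in> I <+>\<^bsub>R\<^esub> J"
      by (metis set_addI)
  next
    fix x assume "x \<in> I <+>\<^bsub>R\<^esub> J"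
    then obtain i j where ij: "i \<in> I" "j \<in> J" "x = i \<oplus> j"
      by (auto simp: set_add_def')
    have "x = (\<zero> \<oplus> j) \<oplus> (i \<oplus> \<zero>)"
      using ij by (simp add: a_comm)
    thus "x \<in> (I' <+>\<^bsub>R\<^esub> J) <+>\<^bsub>R\<^esub> (I <+>\<^bsub>R\<^esub> J')"
      using ij I'.zero_closed J'.zero_closed by (metis set_addI)
  qed
qed

text \<open>If \<open>x = i' + j = i + j'\<close>, then \<open>k = j - j' = i - i'\<close> lies in \<open>I \<inter> J\<close>, and \<open>x = i' + k + j'\<close>.\<close>

lemma (in cring) inter_of_sums:
  assumes "ideal I R" "ideal J R" "ideal I' R" "ideal J' R" "I' \<subseteq> I" "J' \<subseteq> J"
  shows "(I' <+>\<^bsub>R\<^esub> J) \<inter> (I <+>\<^bsub>R\<^esub> J') = I' <+>\<^bsub>R\<^esub> (I \<inter> J) <+>\<^bsub>R\<^esub> J'"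
proof -
  interpret I: ideal I R by fact
  interpret J: ideal J R by fact
  interpret I': ideal I' R by fact
  interpret J': ideal J' R by fact
  show ?thesis
  proof (intro equalityI subsetI)
    fix x assume "x \<in> (I' <+>\<^bsub>R\<^esub> J) \<inter> (I <+>\<^bsub>R\<^esub> J')"
    then obtain i' j i j' where x: "i' \<in> I'" "j \<in> J" "i \<in> I" "j' \<in> J'" "x = i' \<oplus> j" "x = i \<oplus> j'"
      by (auto simp: set_add_def')
    hence c: "i' \<in> carrier R" "j \<in> carrier R" "i \<in> carrier R" "j' \<in> carrier R"
      by auto
    have "j \<ominus> j' = i \<ominus> i'"
    proof -
      have "j \<ominus> j' = (i' \<oplus> j) \<ominus> (i' \<oplus> j')"
        using c by algebra
      also have "\<dots> = (i \<oplus> j') \<ominus> (i' \<oplus> j')"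
        using x by simp
      also have "\<dots> = i \<ominus> i'"
        using c by algebra
      finally show ?thesis .
    qed
    moreover have "j \<ominus> j' \<in> J" "i \<ominus> i' \<in> I"
      using x assms(5,6) unfolding a_minus_def by blast+
    moreover have "x = (i' \<oplus> (j \<ominus> j')) \<oplus> j'"
      unfolding x(5) using c by algebra
    ultimately show "x \<in> I' <+>\<^bsub>R\<^esub> (I \<inter> J) <+>\<^bsub>R\<^esub> J'"
      using x by (metis IntI set_addI)
  next
    fix x assume "x \<in> I' <+>\<^bsub>R\<^esub> (I \<inter> J) <+>\<^bsub>R\<^esub> J'"
    then obtain i' k j' where x: "i' \<in> I'" "k \<in> I" "k \<in> J" "j' \<in> J'" "x = (i' \<oplus> k) \<oplus> j'"
      by (auto simp: set_add_def')
    hence "x = i' \<oplus> (k \<oplus> j')"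
      by (simp add: a_assoc)
    moreover have "i' \<oplus> k \<in> I" "k \<oplus> j' \<in> J"
      using x assms(5,6) by auto
    ultimately show "x \<in> (I' <+>\<^bsub>R\<^esub> J) \<inter> (I <+>\<^bsub>R\<^esub> J')"
      using x by (metis IntI set_addI)
  qed
qed


section \<open>Modules, quotients and homomorphisms\<close>

lemma module_homD:
  assumes "f \<in> module_hom R M N"
  shows "\<And>x. x \<in> carrier M \<Longrightarrow> f x \<in> carrier N"
    and "\<And>x y. x \<in> carrier M \<Longrightarrow> y \<in> carrier M \<Longrightarrow> f (x \<oplus>\<^bsub>M\<^esub> y) = f x \<oplus>\<^bsub>N\<^esub> f y"
    and "\<And>a x. a \<in> carrier R \<Longrightarrow> x \<in> carrier M \<Longrightarrow> f (a \<odot>\<^bsub>M\<^esub> x) = a \<odot>\<^bsub>N\<^esub> f x"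
  using assms by (auto simp: module_hom_def)

lemma module_homI:
  assumes "\<And>x. x \<in> carrier M \<Longrightarrow> f x \<in> carrier N"
    and "\<And>x y. x \<in> carrier M \<Longrightarrow> y \<in> carrier M \<Longrightarrow> f (x \<oplus>\<^bsub>M\<^esub> y) = f x \<oplus>\<^bsub>N\<^esub> f y"
    and "\<And>a x. a \<in> carrier R \<Longrightarrow> x \<in> carrier M \<Longrightarrow> f (a \<odot>\<^bsub>M\<^esub> x) = a \<odot>\<^bsub>N\<^esub> f x"
  shows "f \<in> module_hom R M N"
  using assms by (auto simp: module_hom_def)

lemma module_hom_cong:
  assumes "module R M" "f \<in> module_hom R M N" "\<And>x. x \<in> carrier M \<Longrightarrow> g x = f x"
  shows "g \<in> module_hom R M N"
proof -
  interpret M: module R M by fact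
  show ?thesis
    using module_homD[OF assms(2)] assms(3) by (intro module_homI) simp_all
qed

lemma module_hom_comp:
  assumes "f \<in> module_hom R M N" "g \<in> module_hom R N P"
  shows "(\<lambda>x. g (f x)) \<in> module_hom R M P"
  using module_homD[OF assms(1)] module_homD[OF assms(2)] by (intro module_homI) auto

lemma module_hom_zero:
  assumes "module R M" "module R N" "f \<in> module_hom R M N"
  shows "f \<zero>\<^bsub>M\<^esub> = \<zero>\<^bsub>N\<^esub>"
proof -
  interpret M: module R M by fact
  interpret N: module R N by fact
  have "f \<zero>\<^bsub>M\<^esub> = f (\<zero>\<^bsub>R\<^esub> \<odot>\<^bsub>M\<^esub> \<zero>\<^bsub>M\<^esub>)"
    by simp
  also have "\<dots> = \<zero>\<^bsub>R\<^esub> \<odot>\<^bsub>N\<^esub> f \<zero>\<^bsub>M\<^esub>"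
    by (rule module_homD(3)[OF assms(3)]) auto
  also have "\<dots> = \<zero>\<^bsub>N\<^esub>"
    using module_homD(1)[OF assms(3)] by simp
  finally show ?thesis .
qed

lemma zero_module_hom:
  assumes "module R N"
  shows "(\<lambda>_. \<zero>\<^bsub>N\<^esub>) \<in> module_hom R M N"
proof -
  interpret N: module R N by fact
  show ?thesis by (intro module_homI) auto
qed

lemma module_hom_minus:
  assumes "module R M" "module R N" "f \<in> module_hom R M N" "x \<in> carrier M" "y \<in> carrier M"
  shows "f (x \<ominus>\<^bsub>M\<^esub> y) = f x \<ominus>\<^bsub>N\<^esub> f y"
proof -
  interpret M: module R M by fact
  interpret N: module R N by fact
  have minus: "\<ominus>\<^bsub>M\<^esub> y = (\<ominus>\<^bsub>R\<^esub> \<one>\<^bsub>R\<^esub>) \<odot>\<^bsub>M\<^esub> y" "\<ominus>\<^bsub>N\<^esub> f y = (\<ominus>\<^bsub>R\<^esub> \<one>\<^bsub>R\<^esub>) \<odot>\<^bsub>N\<^esub> f y"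
    using assms(5) module_homD(1)[OF assms(3)] by (simp_all add: M.smult_l_minus N.smult_l_minus)
  show ?thesis
    unfolding a_minus_def minus using assms(4,5) by (simp add: module_homD[OF assms(3)])
qed

lemma submodule_kernel:
  assumes "module R M" "module R N" "f \<in> module_hom R M N"
  shows "submodule {x \<in> carrier M. f x = \<zero>\<^bsub>N\<^esub>} R M"
proof -
  interpret M: module R M by fact
  interpret N: module R N by fact
  have "\<ominus>\<^bsub>M\<^esub> x = (\<ominus>\<^bsub>R\<^esub> \<one>\<^bsub>R\<^esub>) \<odot>\<^bsub>M\<^esub> x" if "x \<in> carrier M" for x
    using that by (simp add: M.smult_l_minus)
  thus ?thesis
    using module_hom_zero[OF assms] module_homD[OF assms(3)]
    by (intro M.submoduleI) auto
qed

lemma submodule_span_least: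
  assumes "submodule N R M" "S \<subseteq> N"
  shows "submodule_span R M S \<subseteq> N"
  using assms by (auto simp: submodule_span_def)

lemma submodule_span_superset: "S \<subseteq> submodule_span R M S"
  by (auto simp: submodule_span_def)

lemma submodule_submodule_span:
  assumes "module R M" "S \<subseteq> carrier M"
  shows "submodule (submodule_span R M S) R M"
proof -
  interpret M: module R M by fact
  show ?thesis
  proof (rule M.submoduleI)
    show "submodule_span R M S \<subseteq> carrier M"
      using M.carrier_is_submodule assms(2) by (rule submodule_span_least)
  next
    show "\<zero>\<^bsub>M\<^esub> \<in> submodule_span R M S"
      using submodule.axioms(1) subgroup.one_closed
      by (fastforce simp: submodule_span_def)
  qed (auto simp: submodule_span_def M.submoduleE)
qed

lemma quotient_module_simps [simp]:
  "carrier (quotient_module M N) = a_rcosets\<^bsub>M\<^esub> N"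
  "\<zero>\<^bsub>quotient_module M N\<^esub> = N"
  "add (quotient_module M N) = set_add M"
  by (simp_all add: quotient_module_def)

lemma submodule_abelian_subgroup:
  assumes "module R M" "submodule N R M"
  shows "abelian_subgroup N M"
proof -
  interpret M: module R M by fact
  show ?thesis
    using submodule.axioms(1)[OF assms(2)] M.M.abelian_group_axioms
    by (intro abelian_subgroupI3) (auto simp: additive_subgroup_def)
qed

lemma coset_eqI:
  assumes "module R M" "submodule K R M" "u \<in> carrier M" "v \<in> carrier M" "u \<ominus>\<^bsub>M\<^esub> v \<in> K"
  shows "K +>\<^bsub>M\<^esub> u = K +>\<^bsub>M\<^esub> v"
proof -
  interpret M: module R M by fact
  interpret A: abelian_subgroup K M
    using assms(1,2) by (rule submodule_abelian_subgroup)
  have "u = (u \<ominus>\<^bsub>M\<^esub> v) \<oplus>\<^bsub>M\<^esub> v"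
    using assms(3,4) by (simp add: a_minus_def M.a_assoc M.l_neg)
  hence "u \<in> K +>\<^bsub>M\<^esub> v"
    using assms(5) unfolding a_r_coset_def' by blast
  thus ?thesis
    using A.a_repr_independence'[OF _ assms(4)] by simp
qed

lemma quotient_module_add:
  assumes "module R M" "submodule N R M" "x \<in> carrier M" "y \<in> carrier M"
  shows "(N +>\<^bsub>M\<^esub> x) <+>\<^bsub>M\<^esub> (N +>\<^bsub>M\<^esub> y) = N +>\<^bsub>M\<^esub> (x \<oplus>\<^bsub>M\<^esub> y)"
  using abelian_subgroup.a_rcos_sum[OF submodule_abelian_subgroup[OF assms(1,2)] assms(3,4)] .

text \<open>The multiplication is defined as a union over all representatives of the coset; each of them contributes
  the same coset.\<close>

lemma quotient_module_smult:
  assumes "module R M" "submodule N R M" "a \<in> carrier R" "x \<in> carrier M"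
  shows "a \<odot>\<^bsub>quotient_module M N\<^esub> (N +>\<^bsub>M\<^esub> x) = N +>\<^bsub>M\<^esub> (a \<odot>\<^bsub>M\<^esub> x)"
proof -
  interpret M: module R M by fact
  interpret N: submodule N R M by fact
  interpret A: abelian_subgroup N M
    using assms(1,2) by (rule submodule_abelian_subgroup)
  have "N +>\<^bsub>M\<^esub> (a \<odot>\<^bsub>M\<^esub> y) = N +>\<^bsub>M\<^esub> (a \<odot>\<^bsub>M\<^esub> x)" if "y \<in> N +>\<^bsub>M\<^esub> x" for y
  proof -
    obtain h where "h \<in> N" "y = h \<oplus>\<^bsub>M\<^esub> x"
      using \<open>y \<in> _\<close> by (auto simp: a_r_coset_def')
    hence "a \<odot>\<^bsub>M\<^esub> y \<in> N +>\<^bsub>M\<^esub> (a \<odot>\<^bsub>M\<^esub> x)"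
      using assms(3,4) A.a_Hcarr by (auto simp: a_r_coset_def' M.smult_r_distr)
    thus ?thesis
      using A.a_repr_independence' assms(3,4) by (metis M.smult_closed)
  qed
  moreover have "x \<in> N +>\<^bsub>M\<^esub> x"
    using assms(4) by (rule A.a_rcos_self)
  ultimately have "(\<Union>y\<in>N +>\<^bsub>M\<^esub> x. N +>\<^bsub>M\<^esub> (a \<odot>\<^bsub>M\<^esub> y)) = N +>\<^bsub>M\<^esub> (a \<odot>\<^bsub>M\<^esub> x)"
    by blast
  thus ?thesis
    by (simp only: quotient_module_def module.simps)
qed

lemma quotient_module_module:
  assumes "module R M" "submodule N R M"
  shows "module R (quotient_module M N)"
proof -
  interpret M: module R M by fact
  interpret N: submodule N R M by fact
  interpret A: abelian_subgroup N M
    using assms by (rule submodule_abelian_subgroup)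
  have zero: "N = N +>\<^bsub>M\<^esub> \<zero>\<^bsub>M\<^esub>"
    using A.a_subset by (rule M.a_coset_add_zero[symmetric])
  note add = quotient_module_add[OF assms]
  have "abelian_group (quotient_module M N)"
  proof (rule abelian_groupI)
    show "\<zero>\<^bsub>quotient_module M N\<^esub> \<in> carrier (quotient_module M N)"
      using zero by (auto simp: A_RCOSETS_def')
  next
    fix C assume "C \<in> carrier (quotient_module M N)"
    then obtain x where x: "x \<in> carrier M" "C = N +>\<^bsub>M\<^esub> x"
      by (auto simp: A_RCOSETS_def')
    have "(N +>\<^bsub>M\<^esub> \<zero>\<^bsub>M\<^esub>) <+>\<^bsub>M\<^esub> C = C"
      using x by (simp only: add M.zero_closed M.l_zero)
    thus "\<zero>\<^bsub>quotient_module M N\<^esub> \<oplus>\<^bsub>quotient_module M N\<^esub> C = C"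
      using zero by simp
    have "(N +>\<^bsub>M\<^esub> (\<ominus>\<^bsub>M\<^esub> x)) <+>\<^bsub>M\<^esub> C = N +>\<^bsub>M\<^esub> \<zero>\<^bsub>M\<^esub>"
      using x by (simp only: add M.a_inv_closed M.l_neg)
    thus "\<exists>D\<in>carrier (quotient_module M N).
        D \<oplus>\<^bsub>quotient_module M N\<^esub> C = \<zero>\<^bsub>quotient_module M N\<^esub>"
      using x(1) zero by (intro bexI[of _ "N +>\<^bsub>M\<^esub> (\<ominus>\<^bsub>M\<^esub> x)"]) (auto simp: A_RCOSETS_def')
  qed (auto simp: A_RCOSETS_def' add M.a_ac)
  thus ?thesis
    by (intro moduleI)
       (auto simp: A_RCOSETS_def' quotient_module_add[OF assms] quotient_module_smult[OF assms]
          M.smult_l_distr M.smult_r_distr M.smult_assoc1 M.R.cring_axioms)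
qed

lemma quotient_module_proj_hom:
  assumes "module R M" "submodule N R M"
  shows "(\<lambda>x. N +>\<^bsub>M\<^esub> x) \<in> module_hom R M (quotient_module M N)"
  using quotient_module_add[OF assms] quotient_module_smult[OF assms]
  by (intro module_homI) (auto simp: A_RCOSETS_def')

text \<open>The universal property of the quotient, with \<open>g\<close> sending a coset to the common value of \<open>f\<close> on it.\<close>

lemma quotient_module_lift:
  assumes M: "module R M" and P: "module R P" and K: "submodule K R M"
    and f: "f \<in> module_hom R M P" and zero: "\<And>k. k \<in> K \<Longrightarrow> f k = \<zero>\<^bsub>P\<^esub>"
  shows "\<exists>g\<in>module_hom R (quotient_module M K) P. \<forall>x\<in>carrier M. g (K +>\<^bsub>M\<^esub> x) = f x"
proof -
  interpret M: module R M by fact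
  interpret P: module R P by fact
  interpret K: submodule K R M by fact
  interpret A: abelian_subgroup K M
    using M K by (rule submodule_abelian_subgroup)
  define g where "g = (\<lambda>C. the_elem (f ` C))"
  have g: "g (K +>\<^bsub>M\<^esub> x) = f x" if x: "x \<in> carrier M" for x
  proof -
    have "f y = f x" if "y \<in> K +>\<^bsub>M\<^esub> x" for y
    proof -
      obtain k where k: "k \<in> K" "y = k \<oplus>\<^bsub>M\<^esub> x"
        using \<open>y \<in> _\<close> by (auto simp: a_r_coset_def')
      hence "f y = f k \<oplus>\<^bsub>P\<^esub> f x"
        using x A.a_subset module_homD(2)[OF f] by blast
      thus ?thesis
        using zero[OF k(1)] module_homD(1)[OF f x] by simp
    qed
    moreover have "x \<in> K +>\<^bsub>M\<^esub> x"
      using x by (rule A.a_rcos_self)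
    ultimately have "f ` (K +>\<^bsub>M\<^esub> x) = {f x}"
      by blast
    thus ?thesis
      by (simp add: g_def)
  qed
  have "g \<in> module_hom R (quotient_module M K) P"
    using g module_homD[OF f]
    by (intro module_homI)
       (auto simp: A_RCOSETS_def' quotient_module_add[OF M K] quotient_module_smult[OF M K])
  thus ?thesis
    using g by blast
qed

lemma regular_module_simps [simp]:
  "carrier (regular_module R) = carrier R"
  "\<zero>\<^bsub>regular_module R\<^esub> = \<zero>\<^bsub>R\<^esub>"
  "add (regular_module R) = add R"
  "smult (regular_module R) = mult R"
  by (simp_all add: regular_module_def)

lemma a_r_coset_regular_module [simp]: "a_r_coset (regular_module R) = a_r_coset R"
  by (auto simp: a_r_coset_def' fun_eq_iff)

lemma (in cring) regular_module_module: "module R (regular_module R)"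
proof -
  have "abelian_group (regular_module R)"
    by (rule abelian_groupI) (auto simp: a_ac intro: a_comm l_neg)
  thus ?thesis
    by (intro moduleI) (auto simp: l_distr r_distr m_assoc cring_axioms)
qed

lemma (in cring) ideal_submodule:
  assumes "ideal I R"
  shows "submodule I R (regular_module R)"
proof -
  interpret I: ideal I R by fact
  interpret M: module R "regular_module R" by (rule regular_module_module)
  have "\<ominus>\<^bsub>regular_module R\<^esub> x = \<ominus> x" for x
    by (simp add: a_inv_def m_inv_def)
  thus ?thesis
    by (intro M.submoduleI) (auto simp: I.I_l_closed)
qed


section \<open>Free modules\<close>

lemma free_module_simps [simp]:
  "carrier (free_module R B) = {f. (\<forall>b. f b \<in> carrier R) \<and> (\<forall>b. b \<notin> B \<longrightarrow> f b = \<zero>\<^bsub>R\<^esub>) \<and>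
                   finite {b. f b \<noteq> \<zero>\<^bsub>R\<^esub>}}"
  "\<zero>\<^bsub>free_module R B\<^esub> = (\<lambda>b. \<zero>\<^bsub>R\<^esub>)"
  "add (free_module R B) = (\<lambda>f g b. f b \<oplus>\<^bsub>R\<^esub> g b)"
  "smult (free_module R B) = (\<lambda>a f b. a \<otimes>\<^bsub>R\<^esub> f b)"
  by (simp_all add: free_module_def)

lemma (in cring) free_module_module:
  fixes B :: "'c set"
  shows "module R (free_module R B)"
proof -
  have add: "finite {b. f b \<oplus> g b \<noteq> \<zero>}"
    if "finite {b. f b \<noteq> \<zero>}" "finite {b. g b \<noteq> \<zero>}" for f g :: "'c \<Rightarrow> 'a"
    using that by (auto intro!: finite_subset[of _ "{b. f b \<noteq> \<zero>} \<union> {b. g b \<noteq> \<zero>}"])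
  have smult: "finite {b. a \<otimes> f b \<noteq> \<zero>}"
    if "finite {b. f b \<noteq> \<zero>}" "a \<in> carrier R" for a and f :: "'c \<Rightarrow> 'a"
    using that by (auto intro!: finite_subset[of _ "{b. f b \<noteq> \<zero>}"])
  have neg: "\<exists>g. (\<forall>b. g b \<in> carrier R) \<and> (\<forall>b. b \<notin> B \<longrightarrow> g b = \<zero>) \<and> finite {b. g b \<noteq> \<zero>} \<and>
      (\<lambda>b. f b \<oplus> g b) = (\<lambda>b. \<zero>)"
    if "\<forall>b. f b \<in> carrier R" "\<forall>b. b \<notin> B \<longrightarrow> f b = \<zero>" "finite {b. f b \<noteq> \<zero>}" for f
    using that by (intro exI[of _ "\<lambda>b. \<ominus> f b"])
      (auto simp: r_neg intro!: finite_subset[of _ "{b. f b \<noteq> \<zero>}"])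
  have "abelian_group (free_module R B)"
    using add neg by (intro abelian_groupI) (auto simp: a_ac)
  thus ?thesis
    using add smult by (intro moduleI) (auto simp: l_distr r_distr m_assoc cring_axioms)
qed

lemma (in cring) basis_vec_closed:
  assumes "b \<in> B"
  shows "basis_vec R b \<in> carrier (free_module R B)"
  using assms by (auto simp: basis_vec_def intro: finite_subset[of _ "{b}"])

text \<open>By induction on the support: setting one nonzero coordinate to zero splits off a multiple of a basis vector.\<close>

lemma (in cring) free_module_induct [consumes 1, case_names zero basis add smult]:
  assumes "v \<in> carrier (free_module R B)"
    and "P \<zero>\<^bsub>free_module R B\<^esub>"
    and "\<And>b. b \<in> B \<Longrightarrow> P (basis_vec R b)"
    and "\<And>u w. u \<in> carrier (free_module R B) \<Longrightarrow> w \<in> carrier (free_module R B) \<Longrightarrow> P u \<Longrightarrow> P w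
        \<Longrightarrow> P (u \<oplus>\<^bsub>free_module R B\<^esub> w)"
    and "\<And>a u. a \<in> carrier R \<Longrightarrow> u \<in> carrier (free_module R B) \<Longrightarrow> P u
        \<Longrightarrow> P (a \<odot>\<^bsub>free_module R B\<^esub> u)"
  shows "P v"
proof -
  let ?F = "free_module R B"
  interpret F: module R ?F by (rule free_module_module)
  have "finite {b. v b \<noteq> \<zero>}"
    using assms(1) by simp
  moreover have "{b. v b \<noteq> \<zero>} \<subseteq> {b. v b \<noteq> \<zero>}" ..
  ultimately show ?thesis
    using assms(1)
  proof (induction "{b. v b \<noteq> \<zero>}" arbitrary: v rule: finite_psubset_induct)
    case psubset
    show ?case
    proof (cases "v = \<zero>\<^bsub>?F\<^esub>")
      case True
      thus ?thesis using assms(2) by simp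
    next
      case False
      then obtain b where b: "v b \<noteq> \<zero>"
        by auto
      define w where "w = v(b := \<zero>)"
      have w: "w \<in> carrier ?F"
        using psubset.prems by (auto simp: w_def intro: finite_subset[of _ "{b. v b \<noteq> \<zero>}"])
      have bB: "b \<in> B" and vb: "v b \<in> carrier R"
        using psubset.prems b by auto
      have "P w"
        using b w by (intro psubset.hyps) (auto simp: w_def)
      moreover have "P (v b \<odot>\<^bsub>?F\<^esub> basis_vec R b)"
        using assms(5)[OF vb basis_vec_closed[OF bB] assms(3)[OF bB]] .
      moreover have "v b \<odot>\<^bsub>?F\<^esub> basis_vec R b \<in> carrier ?F"
        using vb basis_vec_closed[OF bB] by (rule F.smult_closed)
      moreover have "v = w \<oplus>\<^bsub>?F\<^esub> (v b \<odot>\<^bsub>?F\<^esub> basis_vec R b)"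
        using psubset.prems by (auto simp: w_def basis_vec_def fun_eq_iff)
      ultimately show ?thesis
        using assms(4) w by metis
    qed
  qed
qed

lemma (in cring) free_module_hom_ext:
  assumes "module R N" "f \<in> module_hom R (free_module R B) N" "g \<in> module_hom R (free_module R B) N"
    and "\<And>b. b \<in> B \<Longrightarrow> f (basis_vec R b) = g (basis_vec R b)"
    and "v \<in> carrier (free_module R B)"
  shows "f v = g v"
  using assms(5)
proof (induction rule: free_module_induct)
  case zero
  show ?case
    using module_hom_zero[OF free_module_module assms(1)] assms(2,3) by metis
qed (use assms(4) module_homD[OF assms(2)] module_homD[OF assms(3)] in metis)+

text \<open>The universal property of the free module: \<open>f\<close> is \<open>v \<mapsto> \<Sum> v(b) c(b)\<close>, summed over the support of \<open>v\<close>.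
  Additivity requires comparing supports, so the sum is first rewritten over any finite set that contains
  the support.\<close>

lemma (in cring) free_module_lift:
  assumes P: "module R P" and c: "\<And>b. b \<in> B \<Longrightarrow> c b \<in> carrier P"
  shows "\<exists>f\<in>module_hom R (free_module R B) P. \<forall>b\<in>B. f (basis_vec R b) = c b"
proof -
  interpret P: module R P by fact
  let ?F = "free_module R B"
  define f where "f v = finsum P (\<lambda>b. v b \<odot>\<^bsub>P\<^esub> c b) {b. v b \<noteq> \<zero>}" for v
  have cv: "v b \<odot>\<^bsub>P\<^esub> c b \<in> carrier P" if "v \<in> carrier ?F" "b \<in> B" for v b
    using that c by auto
  have f_super: "f v = finsum P (\<lambda>b. v b \<odot>\<^bsub>P\<^esub> c b) A"
    if "v \<in> carrier ?F" "finite A" "{b. v b \<noteq> \<zero>} \<subseteq> A" "A \<subseteq> B" for v A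
    unfolding f_def using that cv[of v] c
    by (intro P.add.finprod_mono_neutral_cong_left) (auto simp: subset_iff)
  have supp: "finite {b. v b \<noteq> \<zero>}" "{b. v b \<noteq> \<zero>} \<subseteq> B" if "v \<in> carrier ?F" for v
    using that by auto
  interpret F: module R ?F by (rule free_module_module)
  have "f \<in> module_hom R ?F P"
  proof (rule module_homI)
    fix v assume v: "v \<in> carrier ?F"
    show "f v \<in> carrier P"
      unfolding f_def using cv[OF v] supp[OF v] by (intro P.finsum_closed) auto
  next
    fix v w assume v: "v \<in> carrier ?F" and w: "w \<in> carrier ?F"
    let ?A = "{b. v b \<noteq> \<zero>} \<union> {b. w b \<noteq> \<zero>}"
    have A: "finite ?A" "?A \<subseteq> B"
      using supp[OF v] supp[OF w] by auto
    have "f (v \<oplus>\<^bsub>?F\<^esub> w) = finsum P (\<lambda>b. (v \<oplus>\<^bsub>?F\<^esub> w) b \<odot>\<^bsub>P\<^esub> c b) ?A"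
      using A F.a_closed[OF v w] by (intro f_super) auto
    also have "\<dots> = finsum P (\<lambda>b. v b \<odot>\<^bsub>P\<^esub> c b \<oplus>\<^bsub>P\<^esub> w b \<odot>\<^bsub>P\<^esub> c b) ?A"
      using A v w c cv by (intro P.finsum_cong') (auto simp: P.smult_l_distr subset_iff)
    also have "\<dots> = finsum P (\<lambda>b. v b \<odot>\<^bsub>P\<^esub> c b) ?A \<oplus>\<^bsub>P\<^esub> finsum P (\<lambda>b. w b \<odot>\<^bsub>P\<^esub> c b) ?A"
      using A cv[OF v] cv[OF w] by (intro P.finsum_addf) blast+
    also have "\<dots> = f v \<oplus>\<^bsub>P\<^esub> f w"
      using f_super[OF v A(1) _ A(2)] f_super[OF w A(1) _ A(2)] by simp
    finally show "f (v \<oplus>\<^bsub>?F\<^esub> w) = f v \<oplus>\<^bsub>P\<^esub> f w" .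
  next
    fix a v assume a: "a \<in> carrier R" and v: "v \<in> carrier ?F"
    let ?A = "{b. v b \<noteq> \<zero>}"
    have "f (a \<odot>\<^bsub>?F\<^esub> v) = finsum P (\<lambda>b. (a \<odot>\<^bsub>?F\<^esub> v) b \<odot>\<^bsub>P\<^esub> c b) ?A"
      using supp[OF v] F.smult_closed[OF a v] a by (intro f_super) auto
    also have "\<dots> = finsum P (\<lambda>b. a \<odot>\<^bsub>P\<^esub> (v b \<odot>\<^bsub>P\<^esub> c b)) ?A"
      using supp[OF v] v a c cv by (intro P.finsum_cong') (auto simp: P.smult_assoc1 subset_iff)
    also have "\<dots> = a \<odot>\<^bsub>P\<^esub> f v"
      unfolding f_def using supp[OF v] a cv[OF v]
      by (intro P.finsum_smult_ldistr[symmetric]) auto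
    finally show "f (a \<odot>\<^bsub>?F\<^esub> v) = a \<odot>\<^bsub>P\<^esub> f v" .
  qed
  moreover have "f (basis_vec R b) = c b" if "b \<in> B" for b
  proof -
    have "f (basis_vec R b) = finsum P (\<lambda>x. basis_vec R b x \<odot>\<^bsub>P\<^esub> c x) {b}"
      using that basis_vec_closed[OF that] by (intro f_super) (auto simp: basis_vec_def)
    thus ?thesis
      using c[OF that] by (simp add: basis_vec_def)
  qed
  ultimately show ?thesis
    by blast
qed


section \<open>Tensor products\<close>

lemma (in cring) tensor_relations_closed:
  assumes "module R M" "module R N"
  shows "tensor_relations R M N \<subseteq> carrier (free_module R (carrier M \<times> carrier N))"
proof -
  interpret M: module R M by fact
  interpret N: module R N by fact
  let ?F = "free_module R (carrier M \<times> carrier N)"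
  interpret F: module R ?F by (rule free_module_module)
  have e: "basis_vec R (x, y) \<in> carrier ?F" if "x \<in> carrier M" "y \<in> carrier N" for x y
    using that by (intro basis_vec_closed) auto
  show ?thesis
    unfolding tensor_relations_def Let_def
    by (auto simp del: free_module_simps
        intro!: e F.minus_closed F.a_closed F.smult_closed M.a_closed N.a_closed M.smult_closed N.smult_closed)
qed

lemma (in cring) tensor_kernel_submodule:
  assumes "module R M" "module R N"
  shows "submodule (tensor_kernel R M N) R (free_module R (carrier M \<times> carrier N))"
  unfolding tensor_kernel_def
  by (intro submodule_submodule_span free_module_module tensor_relations_closed assms)

lemma (in cring) tensor_product_module:
  assumes "module R M" "module R N"
  shows "module R (tensor_product R M N)"
  unfolding tensor_product_def
  by (intro quotient_module_module free_module_module tensor_kernel_submodule assms)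

lemma (in cring) pure_tensor_closed:
  assumes "module R M" "module R N" "x \<in> carrier M" "y \<in> carrier N"
  shows "pure_tensor R M N x y \<in> carrier (tensor_product R M N)"
  unfolding tensor_product_def pure_tensor_def
  using assms
  by (intro module_homD(1)[OF quotient_module_proj_hom[OF free_module_module tensor_kernel_submodule]]
        basis_vec_closed) auto

lemma (in cring) pure_tensor_smult:
  assumes "module R M" "module R N" "a \<in> carrier R" "x \<in> carrier M" "y \<in> carrier N"
  shows "pure_tensor R M N (a \<odot>\<^bsub>M\<^esub> x) y = a \<odot>\<^bsub>tensor_product R M N\<^esub> pure_tensor R M N x y"
    and "pure_tensor R M N x (a \<odot>\<^bsub>N\<^esub> y) = a \<odot>\<^bsub>tensor_product R M N\<^esub> pure_tensor R M N x y"
proof -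
  interpret M: module R M by fact
  interpret N: module R N by fact
  let ?F = "free_module R (carrier M \<times> carrier N)" and ?K = "tensor_kernel R M N"
  interpret F: module R ?F by (rule free_module_module)
  note K = tensor_kernel_submodule[OF assms(1,2)]
  have e: "basis_vec R (x, y) \<in> carrier ?F" if "x \<in> carrier M" "y \<in> carrier N" for x y
    using that by (intro basis_vec_closed) auto
  have rel: "tensor_relations R M N \<subseteq> ?K"
    unfolding tensor_kernel_def by (rule submodule_span_superset)
  have "basis_vec R (a \<odot>\<^bsub>M\<^esub> x, y) \<ominus>\<^bsub>?F\<^esub> a \<odot>\<^bsub>?F\<^esub> basis_vec R (x, y) \<in> ?K"
    using assms(3-5)
    by (intro subsetD[OF rel]) (unfold tensor_relations_def Let_def, blast)
  hence "?K +>\<^bsub>?F\<^esub> basis_vec R (a \<odot>\<^bsub>M\<^esub> x, y) = ?K +>\<^bsub>?F\<^esub> (a \<odot>\<^bsub>?F\<^esub> basis_vec R (x, y))"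
    using assms(3-5) e by (intro coset_eqI[OF F.module_axioms K] F.smult_closed) auto
  thus "pure_tensor R M N (a \<odot>\<^bsub>M\<^esub> x) y = a \<odot>\<^bsub>tensor_product R M N\<^esub> pure_tensor R M N x y"
    unfolding pure_tensor_def tensor_product_def
    using quotient_module_smult[OF F.module_axioms K assms(3) e[OF assms(4,5)]] by simp
  have "basis_vec R (x, a \<odot>\<^bsub>N\<^esub> y) \<ominus>\<^bsub>?F\<^esub> a \<odot>\<^bsub>?F\<^esub> basis_vec R (x, y) \<in> ?K"
    using assms(3-5)
    by (intro subsetD[OF rel]) (unfold tensor_relations_def Let_def, blast)
  hence "?K +>\<^bsub>?F\<^esub> basis_vec R (x, a \<odot>\<^bsub>N\<^esub> y) = ?K +>\<^bsub>?F\<^esub> (a \<odot>\<^bsub>?F\<^esub> basis_vec R (x, y))"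
    using assms(3-5) e by (intro coset_eqI[OF F.module_axioms K] F.smult_closed) auto
  thus "pure_tensor R M N x (a \<odot>\<^bsub>N\<^esub> y) = a \<odot>\<^bsub>tensor_product R M N\<^esub> pure_tensor R M N x y"
    unfolding pure_tensor_def tensor_product_def
    using quotient_module_smult[OF F.module_axioms K assms(3) e[OF assms(4,5)]] by simp
qed

lemma (in cring) pure_tensor_zero_right:
  assumes "module R M" "module R N" "x \<in> carrier M"
  shows "pure_tensor R M N x \<zero>\<^bsub>N\<^esub> = \<zero>\<^bsub>tensor_product R M N\<^esub>"
proof -
  interpret N: module R N by fact
  interpret T: module R "tensor_product R M N"
    using assms(1,2) by (rule tensor_product_module)
  have "pure_tensor R M N x (\<zero> \<odot>\<^bsub>N\<^esub> \<zero>\<^bsub>N\<^esub>) = \<zero> \<odot>\<^bsub>tensor_product R M N\<^esub> pure_tensor R M N x \<zero>\<^bsub>N\<^esub>"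
    using assms by (intro pure_tensor_smult(2)) auto
  thus ?thesis
    using pure_tensor_closed[OF assms N.zero_closed] by simp
qed

text \<open>The universal property of the tensor product: the linear extension of \<open>\<beta>\<close> to the free module on pairs
  kills the defining relations because \<open>\<beta>\<close> is bilinear, hence it kills the submodule that they
  span and descends to the quotient.\<close>

lemma (in cring) tensor_product_lift:
  assumes M: "module R M" and N: "module R N" and P: "module R P"
    and left: "\<And>y. y \<in> carrier N \<Longrightarrow> (\<lambda>x. \<beta> x y) \<in> module_hom R M P"
    and right: "\<And>x. x \<in> carrier M \<Longrightarrow> \<beta> x \<in> module_hom R N P"
  shows "\<exists>g\<in>module_hom R (tensor_product R M N) P.
    \<forall>x\<in>carrier M. \<forall>y\<in>carrier N. g (pure_tensor R M N x y) = \<beta> x y"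
proof -
  interpret M: module R M by fact
  interpret N: module R N by fact
  interpret P: module R P by fact
  let ?F = "free_module R (carrier M \<times> carrier N)" and ?K = "tensor_kernel R M N"
  interpret F: module R ?F by (rule free_module_module)
  note K = tensor_kernel_submodule[OF M N]
  have e: "basis_vec R (x, y) \<in> carrier ?F" if "x \<in> carrier M" "y \<in> carrier N" for x y
    using that by (intro basis_vec_closed) auto
  have \<beta>: "\<beta> x y \<in> carrier P" if "x \<in> carrier M" "y \<in> carrier N" for x y
    using module_homD(1)[OF right] that by blast
  obtain f where f: "f \<in> module_hom R ?F P"
    and fe: "\<And>x y. x \<in> carrier M \<Longrightarrow> y \<in> carrier N \<Longrightarrow> f (basis_vec R (x, y)) = \<beta> x y"
    using free_module_lift[OF P, of "carrier M \<times> carrier N" "\<lambda>(x, y). \<beta> x y"] \<beta> by auto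
  have kill: "f (u \<ominus>\<^bsub>?F\<^esub> v) = \<zero>\<^bsub>P\<^esub>" if "u \<in> carrier ?F" "v \<in> carrier ?F" "f u = f v" for u v
    unfolding module_hom_minus[OF F.module_axioms P f that(1,2)] that(3)
    using module_homD(1)[OF f that(2)] by (simp add: a_minus_def P.r_neg)
  have "f k = \<zero>\<^bsub>P\<^esub>" if "k \<in> tensor_relations R M N" for k
    using that unfolding tensor_relations_def Let_def
  proof (elim UnE CollectE exE conjE)
    fix x x' y
    assume k: "k = basis_vec R (x \<oplus>\<^bsub>M\<^esub> x', y) \<ominus>\<^bsub>?F\<^esub> (basis_vec R (x, y) \<oplus>\<^bsub>?F\<^esub> basis_vec R (x', y))"
      and c: "x \<in> carrier M" "x' \<in> carrier M" "y \<in> carrier N"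
    have "f (basis_vec R (x \<oplus>\<^bsub>M\<^esub> x', y)) = f (basis_vec R (x, y) \<oplus>\<^bsub>?F\<^esub> basis_vec R (x', y))"
      unfolding module_homD(2)[OF f e[OF c(1,3)] e[OF c(2,3)]] fe[OF c(1,3)] fe[OF c(2,3)]
        fe[OF M.a_closed[OF c(1,2)] c(3)]
      by (rule module_homD(2)[OF left[OF c(3)] c(1,2)])
    thus ?thesis
      unfolding k by (intro kill e F.a_closed M.a_closed c)
  next
    fix x y y'
    assume k: "k = basis_vec R (x, y \<oplus>\<^bsub>N\<^esub> y') \<ominus>\<^bsub>?F\<^esub> (basis_vec R (x, y) \<oplus>\<^bsub>?F\<^esub> basis_vec R (x, y'))"
      and c: "x \<in> carrier M" "y \<in> carrier N" "y' \<in> carrier N"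
    have "f (basis_vec R (x, y \<oplus>\<^bsub>N\<^esub> y')) = f (basis_vec R (x, y) \<oplus>\<^bsub>?F\<^esub> basis_vec R (x, y'))"
      unfolding module_homD(2)[OF f e[OF c(1,2)] e[OF c(1,3)]] fe[OF c(1,2)] fe[OF c(1,3)]
        fe[OF c(1) N.a_closed[OF c(2,3)]]
      by (rule module_homD(2)[OF right[OF c(1)] c(2,3)])
    thus ?thesis
      unfolding k by (intro kill e F.a_closed N.a_closed c)
  next
    fix a x y
    assume k: "k = basis_vec R (a \<odot>\<^bsub>M\<^esub> x, y) \<ominus>\<^bsub>?F\<^esub> a \<odot>\<^bsub>?F\<^esub> basis_vec R (x, y)"
      and c: "a \<in> carrier R" "x \<in> carrier M" "y \<in> carrier N"
    have "f (basis_vec R (a \<odot>\<^bsub>M\<^esub> x, y)) = f (a \<odot>\<^bsub>?F\<^esub> basis_vec R (x, y))"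
      unfolding module_homD(3)[OF f c(1) e[OF c(2,3)]] fe[OF c(2,3)] fe[OF M.smult_closed[OF c(1,2)] c(3)]
      by (rule module_homD(3)[OF left[OF c(3)] c(1,2)])
    thus ?thesis
      unfolding k by (intro kill e F.smult_closed M.smult_closed c)
  next
    fix a x y
    assume k: "k = basis_vec R (x, a \<odot>\<^bsub>N\<^esub> y) \<ominus>\<^bsub>?F\<^esub> a \<odot>\<^bsub>?F\<^esub> basis_vec R (x, y)"
      and c: "a \<in> carrier R" "x \<in> carrier M" "y \<in> carrier N"
    have "f (basis_vec R (x, a \<odot>\<^bsub>N\<^esub> y)) = f (a \<odot>\<^bsub>?F\<^esub> basis_vec R (x, y))"
      unfolding module_homD(3)[OF f c(1) e[OF c(2,3)]] fe[OF c(2,3)] fe[OF c(2) N.smult_closed[OF c(1,3)]]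
      by (rule module_homD(3)[OF right[OF c(2)] c(1,3)])
    thus ?thesis
      unfolding k by (intro kill e F.smult_closed N.smult_closed c)
  qed
  hence "?K \<subseteq> {w \<in> carrier ?F. f w = \<zero>\<^bsub>P\<^esub>}"
    unfolding tensor_kernel_def using tensor_relations_closed[OF M N]
    by (intro submodule_span_least submodule_kernel F.module_axioms P f) blast
  hence "f k = \<zero>\<^bsub>P\<^esub>" if "k \<in> ?K" for k
    using that by blast
  then obtain g where g: "g \<in> module_hom R (tensor_product R M N) P"
    and g_coset: "\<And>w. w \<in> carrier ?F \<Longrightarrow> g (?K +>\<^bsub>?F\<^esub> w) = f w"
    using quotient_module_lift[OF F.module_axioms P K f] unfolding tensor_product_def by metis
  have "g (pure_tensor R M N x y) = \<beta> x y" if "x \<in> carrier M" "y \<in> carrier N" for x y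
    unfolding pure_tensor_def g_coset[OF e[OF that]] fe[OF that] ..
  thus ?thesis
    using g by blast
qed

lemma (in cring) tensor_product_hom_ext:
  assumes "module R M" "module R N" "module R P"
    and f: "f \<in> module_hom R (tensor_product R M N) P"
    and g: "g \<in> module_hom R (tensor_product R M N) P"
    and eq: "\<And>x y. x \<in> carrier M \<Longrightarrow> y \<in> carrier N
      \<Longrightarrow> f (pure_tensor R M N x y) = g (pure_tensor R M N x y)"
    and t: "t \<in> carrier (tensor_product R M N)"
  shows "f t = g t"
proof -
  let ?F = "free_module R (carrier M \<times> carrier N)" and ?K = "tensor_kernel R M N"
  have p: "(\<lambda>w. ?K +>\<^bsub>?F\<^esub> w) \<in> module_hom R ?F (tensor_product R M N)"
    unfolding tensor_product_def
    using free_module_module tensor_kernel_submodule[OF assms(1,2)] by (rule quotient_module_proj_hom)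
  obtain w where w: "w \<in> carrier ?F" "t = ?K +>\<^bsub>?F\<^esub> w"
    using t unfolding tensor_product_def quotient_module_simps A_RCOSETS_def' by blast
  have "f (?K +>\<^bsub>?F\<^esub> w) = g (?K +>\<^bsub>?F\<^esub> w)"
  proof (rule free_module_hom_ext[OF assms(3) module_hom_comp[OF p f] module_hom_comp[OF p g] _ w(1)])
    fix b assume "b \<in> carrier M \<times> carrier N"
    then obtain x y where "x \<in> carrier M" "y \<in> carrier N" "b = (x, y)"
      by blast
    thus "f (?K +>\<^bsub>?F\<^esub> basis_vec R b) = g (?K +>\<^bsub>?F\<^esub> basis_vec R b)"
      using eq by (simp only: pure_tensor_def)
  qed
  thus ?thesis
    using w(2) by simp
qed


section \<open>Vanishing of the first Tor\<close>

text \<open>The natural map \<open>(I \<inter> J)/(I J) \<rightarrow> Tor\<^sub>1(R/I, R/J)\<close> sends \<open>a\<close> to the class of \<open>f \<otimes> 1\<close>, where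
  \<open>d\<^sub>0 f = a e\<close> and \<open>e\<close> lies over \<open>1\<close>. The homomorphism \<open>\<Lambda>\<close> below undoes this map: it is defined on all of
  \<open>F\<^sub>1 \<otimes> R/J\<close>, kills the boundaries and sends \<open>f \<otimes> 1\<close> to \<open>I J + a\<close>. So vanishing of the homology
  forces \<open>a \<in> I J\<close>.\<close>

lemma (in cring) Tor_1_vanishes_imp_inter_eq_prod:
  assumes I: "ideal I R" and J: "ideal J R"
    and Tor: "Tor_vanishes R 1 (quotient_module (regular_module R) I) (quotient_module (regular_module R) J)"
  shows "I \<inter> J = I \<cdot> J"
proof (intro equalityI subsetI)
  interpret I: ideal I R by fact
  interpret J: ideal J R by fact
  have IJ: "ideal (I \<cdot> J) R"
    using I J by (rule ideal_prod_is_ideal)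
  interpret IJ: ideal "I \<cdot> J" R by fact
  let ?quot = "quotient_module (regular_module R)"
  let ?M = "?quot I" and ?N = "?quot J" and ?P = "?quot (I \<cdot> J)"
  note reg = regular_module_module
  have M: "module R ?M" and N: "module R ?N" and P: "module R ?P"
    by (intro quotient_module_module reg ideal_submodule I J IJ)+
  have smult: "a \<odot>\<^bsub>?quot L\<^esub> (L +> x) = L +> a \<otimes> x"
    if "ideal L R" "a \<in> carrier R" "x \<in> carrier R" for L a x
    using quotient_module_smult[OF reg ideal_submodule[OF that(1)]] that by simp
  have proj: "(\<lambda>x. L +> x) \<in> module_hom R (regular_module R) (?quot L)" if "ideal L R" for L
    using quotient_module_proj_hom[OF reg ideal_submodule[OF that]] by simp
  have coset_carrier: "\<exists>r\<in>carrier R. C = L +> r" if "C \<in> carrier (?quot L)" for L C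
    using that by (auto simp: A_RCOSETS_def')
  have coset_zero: "L +> x = L \<longleftrightarrow> x \<in> L" if "ideal L R" "x \<in> carrier R" for L x
  proof -
    interpret L: ideal L R by fact
    show ?thesis
      using that(2) L.a_rcos_self L.a_rcos_const by metis
  qed
  obtain B :: "nat \<Rightarrow> ('a + 'a set) list set" and d \<epsilon> D
    where res: "free_resolution R ?M B d \<epsilon>"
      and D: "\<And>n. is_tensor_map R (free_module R (B (Suc n))) (free_module R (B n)) ?N (d n) (D n)"
      and exact: "a_kernel (tensor_product R (free_module R (B 1)) ?N)
          (tensor_product R (free_module R (B 0)) ?N) (D 0) =
        D 1 ` carrier (tensor_product R (free_module R (B (Suc 1))) ?N)"
    using Tor unfolding Tor_vanishes_def by auto
  define F where "F n = free_module R (B n)" for n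
  have F: "module R (F n)" for n
    unfolding F_def by (rule free_module_module)
  have eps: "\<epsilon> \<in> module_hom R (F 0) ?M"
    and eps_surj: "\<epsilon> ` carrier (F 0) = carrier ?M"
    and d: "\<And>n. d n \<in> module_hom R (F (Suc n)) (F n)"
    and exact0: "d 0 ` carrier (F 1) = a_kernel (F 0) ?M \<epsilon>"
    and exact1: "d 1 ` carrier (F 2) = a_kernel (F 1) (F 0) (d 0)"
    using res unfolding free_resolution_def Let_def F_def[symmetric] by (auto simp: numeral_2_eq_2)
  have D_hom: "D n \<in> module_hom R (tensor_product R (F (Suc n)) ?N) (tensor_product R (F n) ?N)"
    and D_pure: "\<And>x y. x \<in> carrier (F (Suc n)) \<Longrightarrow> y \<in> carrier ?N \<Longrightarrow>
      D n (pure_tensor R (F (Suc n)) ?N x y) = pure_tensor R (F n) ?N (d n x) y" for n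
    using D unfolding is_tensor_map_def F_def by auto

  \<comment> \<open>A lift \<open>\<phi>\<close> of the augmentation along \<open>R \<rightarrow> R/I\<close>, obtained by lifting its values on the basis.\<close>
  have "\<forall>b\<in>B 0. \<exists>c\<in>carrier R. \<epsilon> (basis_vec R b) = I +> c"
    using module_homD(1)[OF eps] basis_vec_closed coset_carrier unfolding F_def by metis
  then obtain c where c: "\<And>b. b \<in> B 0 \<Longrightarrow> c b \<in> carrier R \<and> \<epsilon> (basis_vec R b) = I +> c b"
    by metis
  obtain \<phi> where \<phi>: "\<phi> \<in> module_hom R (F 0) (regular_module R)"
    and \<phi>_basis: "\<And>b. b \<in> B 0 \<Longrightarrow> \<phi> (basis_vec R b) = c b"
    using free_module_lift[OF reg, of "B 0" c] c unfolding F_def by auto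
  have \<phi>_closed: "\<phi> v \<in> carrier R" if "v \<in> carrier (F 0)" for v
    using module_homD(1)[OF \<phi> that] by simp
  have \<phi>_eps: "I +> \<phi> v = \<epsilon> v" if "v \<in> carrier (F 0)" for v
  proof (rule free_module_hom_ext[OF M, where f = "\<lambda>v. I +> \<phi> v"])
    show "(\<lambda>v. I +> \<phi> v) \<in> module_hom R (free_module R (B 0)) ?M"
      using module_hom_comp[OF \<phi> proj[OF I]] unfolding F_def .
    show "\<epsilon> \<in> module_hom R (free_module R (B 0)) ?M"
      using eps unfolding F_def .
    show "v \<in> carrier (free_module R (B 0))"
      using that unfolding F_def .
    show "I +> \<phi> (basis_vec R b) = \<epsilon> (basis_vec R b)" if "b \<in> B 0" for b
      using c[OF that] \<phi>_basis[OF that] by (simp only:)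
  qed
  define \<psi> where "\<psi> x = \<phi> (d 0 x)" for x
  have \<psi>: "\<psi> \<in> module_hom R (F 1) (regular_module R)"
    using module_hom_comp[OF d[of 0] \<phi>] by (simp add: \<psi>_def[abs_def])
  have \<psi>_I: "\<psi> x \<in> I" if "x \<in> carrier (F 1)" for x
  proof -
    have "d 0 x \<in> a_kernel (F 0) ?M \<epsilon>"
      using exact0 that by blast
    hence "d 0 x \<in> carrier (F 0)" "\<epsilon> (d 0 x) = I"
      by (auto simp: a_kernel_def')
    thus ?thesis
      using \<phi>_eps coset_zero[OF I] \<phi>_closed unfolding \<psi>_def by metis
  qed
  have \<psi>_d: "\<psi> (d 1 x) = \<zero>" if "x \<in> carrier (F 2)" for x
  proof -
    have "d 1 x \<in> a_kernel (F 1) (F 0) (d 0)"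
      using exact1 that by blast
    hence "d 0 (d 1 x) = \<zero>\<^bsub>F 0\<^esub>"
      by (auto simp: a_kernel_def')
    thus ?thesis
      using module_hom_zero[OF F reg \<phi>] by (simp add: \<psi>_def)
  qed

  \<comment> \<open>Multiplication by \<open>p \<in> I\<close> maps \<open>J\<close> into \<open>I J\<close> and so induces \<open>g p : R/J \<rightarrow> R/(I J)\<close>.\<close>
  have "\<exists>g\<in>module_hom R ?N ?P. \<forall>r\<in>carrier R. g (J +> r) = I \<cdot> J +> p \<otimes> r" if p: "p \<in> I" for p
  proof -
    have "(\<lambda>r. p \<otimes> r) \<in> module_hom R (regular_module R) (regular_module R)"
      using p by (intro module_homI) (auto simp: r_distr m_lcomm)
    from module_hom_comp[OF this proj[OF IJ]]
    have "(\<lambda>r. I \<cdot> J +> p \<otimes> r) \<in> module_hom R (regular_module R) ?P" .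
    moreover have "I \<cdot> J +> p \<otimes> j = \<zero>\<^bsub>?P\<^esub>" if "j \<in> J" for j
      using p that coset_zero[OF IJ] ideal_prod.prod[of p I j J R] by simp
    ultimately show ?thesis
      using quotient_module_lift[OF reg P ideal_submodule[OF J]] by simp
  qed
  then obtain g where g: "\<And>p. p \<in> I \<Longrightarrow> g p \<in> module_hom R ?N ?P"
    and g_coset: "\<And>p r. p \<in> I \<Longrightarrow> r \<in> carrier R \<Longrightarrow> g p (J +> r) = I \<cdot> J +> p \<otimes> r"
    by metis
  obtain \<Lambda> where \<Lambda>: "\<Lambda> \<in> module_hom R (tensor_product R (F 1) ?N) ?P"
    and \<Lambda>_pure: "\<And>x y. x \<in> carrier (F 1) \<Longrightarrow> y \<in> carrier ?N \<Longrightarrow> \<Lambda> (pure_tensor R (F 1) ?N x y) = g (\<psi> x) y"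
  proof -
    have "(\<lambda>x. g (\<psi> x) y) \<in> module_hom R (F 1) ?P" if y: "y \<in> carrier ?N" for y
    proof -
      obtain r where r: "r \<in> carrier R" "y = J +> r"
        using coset_carrier[OF y] by blast
      have "(\<lambda>p. p \<otimes> r) \<in> module_hom R (regular_module R) (regular_module R)"
        using r by (intro module_homI) (auto simp: l_distr m_assoc)
      from module_hom_comp[OF module_hom_comp[OF \<psi> this] proj[OF IJ]]
      have hom: "(\<lambda>x. I \<cdot> J +> \<psi> x \<otimes> r) \<in> module_hom R (F 1) ?P" .
      show ?thesis
        using F hom by (rule module_hom_cong) (simp only: r(2) g_coset[OF \<psi>_I r(1)])
    qed
    moreover have "g (\<psi> x) \<in> module_hom R ?N ?P" if "x \<in> carrier (F 1)" for x
      using g \<psi>_I that by blast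
    ultimately show ?thesis
      using tensor_product_lift[OF F[of 1] N P, of "\<lambda>x. g (\<psi> x)"] that by blast
  qed
  have \<Lambda>_D: "\<Lambda> (D 1 t) = I \<cdot> J" if t: "t \<in> carrier (tensor_product R (F 2) ?N)" for t
  proof -
    have D1: "D 1 \<in> module_hom R (tensor_product R (F 2) ?N) (tensor_product R (F 1) ?N)"
      using D_hom[of 1] by (simp add: numeral_2_eq_2)
    have "\<Lambda> (D 1 (pure_tensor R (F 2) ?N x y)) = \<zero>\<^bsub>?P\<^esub>"
      if x: "x \<in> carrier (F 2)" and y: "y \<in> carrier ?N" for x y
    proof -
      obtain r where r: "r \<in> carrier R" "y = J +> r"
        using coset_carrier[OF y] by blast
      have "d 1 x \<in> carrier (F 1)"
        using module_homD(1)[OF d[of 1]] x by (simp add: numeral_2_eq_2)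
      hence "\<Lambda> (pure_tensor R (F 1) ?N (d 1 x) y) = g \<zero> y"
        using \<Lambda>_pure y \<psi>_d[OF x] by simp
      also have "\<dots> = I \<cdot> J"
        using g_coset[OF I.zero_closed r(1)] r coset_zero[OF IJ] by simp
      finally show ?thesis
        using D_pure[of x 1 y] x y by (simp add: numeral_2_eq_2)
    qed
    hence "\<Lambda> (D 1 t) = \<zero>\<^bsub>?P\<^esub>"
      by (rule tensor_product_hom_ext[OF F N P module_hom_comp[OF D1 \<Lambda>] zero_module_hom[OF P] _ t])
    thus ?thesis
      by simp
  qed

  fix a assume "a \<in> I \<inter> J"
  hence a: "a \<in> I" "a \<in> J" "a \<in> carrier R"
    by auto
  have one: "J +> \<one> \<in> carrier ?N" "I +> \<one> \<in> carrier ?M"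
    by (auto simp: A_RCOSETS_def')
  obtain e where e: "e \<in> carrier (F 0)" "\<epsilon> e = I +> \<one>"
    using one(2) unfolding eps_surj[symmetric] by blast
  interpret F0: module R "F 0" by (rule F)
  have "\<epsilon> (a \<odot>\<^bsub>F 0\<^esub> e) = I +> a"
    using a e smult[OF I] by (simp add: module_homD(3)[OF eps])
  hence "a \<odot>\<^bsub>F 0\<^esub> e \<in> a_kernel (F 0) ?M \<epsilon>"
    using a e coset_zero[OF I] by (simp add: a_kernel_def')
  then obtain f where f: "f \<in> carrier (F 1)" "d 0 f = a \<odot>\<^bsub>F 0\<^esub> e"
    unfolding exact0[symmetric] by (metis imageE)
  \<comment> \<open>In \<open>a e \<otimes> 1\<close> the scalar moves to the right factor, where it kills \<open>1\<close> as \<open>a \<in> J\<close>.\<close>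
  have "D 0 (pure_tensor R (F 1) ?N f (J +> \<one>)) = pure_tensor R (F 0) ?N (a \<odot>\<^bsub>F 0\<^esub> e) (J +> \<one>)"
    using D_pure[of f 0] f one by simp
  also have "\<dots> = pure_tensor R (F 0) ?N e (a \<odot>\<^bsub>?N\<^esub> (J +> \<one>))"
    using pure_tensor_smult[OF F N a(3) e(1) one(1)] by simp
  also have "a \<odot>\<^bsub>?N\<^esub> (J +> \<one>) = \<zero>\<^bsub>?N\<^esub>"
    using smult[OF J] a coset_zero[OF J] by simp
  also have "pure_tensor R (F 0) ?N e \<zero>\<^bsub>?N\<^esub> = \<zero>\<^bsub>tensor_product R (F 0) ?N\<^esub>"
    using F N e(1) by (rule pure_tensor_zero_right)
  finally have "pure_tensor R (F 1) ?N f (J +> \<one>) \<in> a_kernel (tensor_product R (F 1) ?N)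
      (tensor_product R (F 0) ?N) (D 0)"
    using pure_tensor_closed[OF F N f(1) one(1)] by (simp add: a_kernel_def')
  then obtain t where t: "t \<in> carrier (tensor_product R (F 2) ?N)"
      "pure_tensor R (F 1) ?N f (J +> \<one>) = D 1 t"
    using exact unfolding F_def[symmetric] by (auto simp: numeral_2_eq_2)
  have "I \<cdot> J +> \<psi> f = \<Lambda> (pure_tensor R (F 1) ?N f (J +> \<one>))"
    using \<Lambda>_pure[OF f(1) one(1)] g_coset[OF \<psi>_I[OF f(1)] one_closed] \<psi>_I[OF f(1)] by simp
  also have "\<dots> = I \<cdot> J"
    using \<Lambda>_D t by simp
  finally have "\<psi> f \<in> I \<cdot> J"
    using coset_zero[OF IJ] \<psi>_I[OF f(1)] by simp
  moreover have "\<psi> f = a \<otimes> \<phi> e"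
    using f(2) a(3) e(1) module_homD(3)[OF \<phi>] by (simp add: \<psi>_def)
  moreover have "\<one> \<ominus> \<phi> e \<in> I"
    using I.a_rcos_module_minus[OF ring_axioms \<phi>_closed[OF e(1)] one_closed]
      \<phi>_eps[OF e(1)] e(2) I.a_rcos_self[OF one_closed] by simp
  hence "(\<one> \<ominus> \<phi> e) \<otimes> a \<in> I \<cdot> J"
    using a(2) by (rule ideal_prod.prod)
  \<comment> \<open>Both summands lie in \<open>I J\<close>.\<close>
  moreover have "a = (\<one> \<ominus> \<phi> e) \<otimes> a \<oplus> a \<otimes> \<phi> e"
    using a(3) \<phi>_closed[OF e(1)] by algebra
  ultimately show "a \<in> I \<cdot> J"
    using IJ.a_closed by metis
qed (use ideal_prod_inter[OF I J] in blast)

theorem proposition2p1: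
  fixes R :: "('a, 'm) ring_scheme" (structure)
    and I I' J J' :: "'a set"
  assumes "cring R"
    and "local_ring R \<or> standard_graded_ring R"
    and "ideal I R" "ideal J R" "ideal I' R" "ideal J' R"
    and "I' \<subseteq> I" "J' \<subseteq> J"
  shows "(I \<inter> J = I \<cdot> J \<longrightarrow>
            R Quot (I' <+> I \<cdot> J <+> J') \<simeq>
              fiber_product (R Quot (I' <+> J)) (R Quot (I <+> J'))
                (quot_proj R (I <+> J)) (quot_proj R (I <+> J)))
         \<and> (Tor_independent R I J \<longrightarrow> I \<inter> J = I \<cdot> J)"
proof (intro conjI impI)
  interpret cring R by fact
  assume "I \<inter> J = I \<cdot> J"
  thus "R Quot (I' <+> I \<cdot> J <+> J') \<simeq>
      fiber_product (R Quot (I' <+> J)) (R Quot (I <+> J'))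
        (quot_proj R (I <+> J)) (quot_proj R (I <+> J))"
    using quot_inter_iso_fiber_product[OF add_ideals[OF assms(5,4)] add_ideals[OF assms(3,6)]]
    unfolding sum_of_sums[OF assms(3-8)] inter_of_sums[OF assms(3-8)] by simp
next
  interpret cring R by fact
  assume "Tor_independent R I J"
  thus "I \<inter> J = I \<cdot> J"
    unfolding Tor_independent_def
    by (intro Tor_1_vanishes_imp_inter_eq_prod[OF assms(3,4)]) simp
qed

end
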